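(* Let $G$ be a distance-regular graph of diameter $2$. Then $G$ exhibits perfect state transfer (for the Grover walk) if and only if $G$ is isomorphic to the cycle $C_4$ or to the complete tripartite graph $K_{2,2,2}$.
   Context: A connected graph $G$ is distance-regular if for any vertices $u,v$ the number of vertices at distance $i$ from $u$ and distance $j$ from $v$ depends only on $i,j$ and $\operatorname{dist}(u,v)$. Grover walk: for a finite simple graph $G$ without isolated vertices, arcs $\mathcal{A}(G)=\{(u,v),(v,u):uv\in E(G)\}$, $t((u,v))=v$, $(u,v)^{-1}=(v,u)$; shift $S_{ab}=\delta_{a,b^{-1}}$; boundary $N_{ua}=\frac{1}{\sqrt{\deg u}}\delta_{u,t(a)}$; $U=S(2N^*N-I)$; $\Phi_u=N^*\mathbf{e}_u$. $G$ exhibits perfect state transfer if there exist vertices $u\ne v$, a positive integer $\tau$ and a unimodular $\gamma\in\mathbb{C}$ with $U^\tau\Phi_u=\gamma\Phi_v$. *)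

theory Defs
  imports Complex_Main "Graph_Theory.Graph_Theory"
begin

text \<open>
  A finite simple graph is a \<^locale>\<open>pair_graph\<close>, that is, a finite symmetric loop-free digraph whose
  arcs are ordered pairs. Hence \<^term>\<open>parcs G\<close> is literally the arc set
  {(u,v), (v,u) : uv is an edge}, and the degree of a vertex in the simple graph is its in-degree.
\<close>

section \<open>Distance-regular graphs\<close>

definition graph_dist :: "'a pair_pre_digraph \<Rightarrow> 'a \<Rightarrow> 'a \<Rightarrow> ereal" where
  "graph_dist G u v = wf_digraph.\<mu> (with_proj G) (\<lambda>_. 1) u v"

definition graph_diameter :: "'a pair_pre_digraph \<Rightarrow> ereal" where
  "graph_diameter G = (SUP (u, v) \<in> pverts G \<times> pverts G. graph_dist G u v)"

definition distance_regular :: "'a pair_pre_digraph \<Rightarrow> bool" where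
  "distance_regular G \<longleftrightarrow> connected (with_proj G) \<and>
     (\<forall>(i::nat) (j::nat). \<forall>u\<in>pverts G. \<forall>v\<in>pverts G. \<forall>u'\<in>pverts G. \<forall>v'\<in>pverts G.
        graph_dist G u v = graph_dist G u' v' \<longrightarrow>
        card {w \<in> pverts G. graph_dist G u w = i \<and> graph_dist G v w = j} =
        card {w \<in> pverts G. graph_dist G u' w = i \<and> graph_dist G v' w = j})"

section \<open>Complex matrices indexed by finite sets\<close>

text \<open>
  Matrices are indexed by vertices and arcs, so they are functions of two indices, and the finite
  index set being summed over is passed explicitly. Only entries at indices in these sets matter.
\<close>

definition mat_prod ::
  "'k set \<Rightarrow> ('i \<Rightarrow> 'k \<Rightarrow> complex) \<Rightarrow> ('k \<Rightarrow> 'j \<Rightarrow> complex) \<Rightarrow> 'i \<Rightarrow> 'j \<Rightarrow> complex" where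
  "mat_prod K A B i j = (\<Sum>k\<in>K. A i k * B k j)"

definition mat_vec_prod ::
  "'k set \<Rightarrow> ('i \<Rightarrow> 'k \<Rightarrow> complex) \<Rightarrow> ('k \<Rightarrow> complex) \<Rightarrow> 'i \<Rightarrow> complex" where
  "mat_vec_prod K A x i = (\<Sum>k\<in>K. A i k * x k)"

definition mat_id :: "'i \<Rightarrow> 'i \<Rightarrow> complex" where
  "mat_id i j = (if i = j then 1 else 0)"

definition mat_adj :: "('i \<Rightarrow> 'j \<Rightarrow> complex) \<Rightarrow> 'j \<Rightarrow> 'i \<Rightarrow> complex" where
  "mat_adj A j i = cnj (A i j)"

primrec mat_pow :: "'i set \<Rightarrow> ('i \<Rightarrow> 'i \<Rightarrow> complex) \<Rightarrow> nat \<Rightarrow> 'i \<Rightarrow> 'i \<Rightarrow> complex" where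
  "mat_pow I A 0 = mat_id"
| "mat_pow I A (Suc n) = mat_prod I A (mat_pow I A n)"

section \<open>Grover walk\<close>

definition shift_mat :: "'a \<times> 'a \<Rightarrow> 'a \<times> 'a \<Rightarrow> complex" where
  "shift_mat a b = (if a = prod.swap b then 1 else 0)"

definition boundary_mat :: "'a pair_pre_digraph \<Rightarrow> 'a \<Rightarrow> 'a \<times> 'a \<Rightarrow> complex" where
  "boundary_mat G u a =
     (if u = head (with_proj G) a
      then complex_of_real (1 / sqrt (real (in_degree (with_proj G) u))) else 0)"

definition grover_mat :: "'a pair_pre_digraph \<Rightarrow> 'a \<times> 'a \<Rightarrow> 'a \<times> 'a \<Rightarrow> complex" where
  "grover_mat G = mat_prod (parcs G) shift_mat
     (\<lambda>a b. 2 * mat_prod (pverts G) (mat_adj (boundary_mat G)) (boundary_mat G) a b - mat_id a b)"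

definition vertex_state :: "'a pair_pre_digraph \<Rightarrow> 'a \<Rightarrow> 'a \<times> 'a \<Rightarrow> complex" where
  "vertex_state G u =
     mat_vec_prod (pverts G) (mat_adj (boundary_mat G)) (\<lambda>w. if w = u then 1 else 0)"

definition perfect_state_transfer :: "'a pair_pre_digraph \<Rightarrow> bool" where
  "perfect_state_transfer G \<longleftrightarrow>
     (\<exists>u\<in>pverts G. \<exists>v\<in>pverts G. \<exists>(\<tau>::nat) (\<gamma>::complex).
        u \<noteq> v \<and> \<tau> > 0 \<and> cmod \<gamma> = 1 \<and>
        (\<forall>a\<in>parcs G. mat_vec_prod (parcs G) (mat_pow (parcs G) (grover_mat G) \<tau>) (vertex_state G u) a
                      = \<gamma> * vertex_state G v a))"

section \<open>Cycles and complete multipartite graphs\<close>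

text \<open>This is the cycle only for \<open>n \<ge> 3\<close>.\<close>

definition cycle_graph :: "nat \<Rightarrow> nat pair_pre_digraph" where
  "cycle_graph n = \<lparr> pverts = {..<n},
     parcs = {(i, j). i < n \<and> j < n \<and> (j = (i + 1) mod n \<or> i = (j + 1) mod n)} \<rparr>"

text \<open>The vertex \<open>(p, k)\<close> is the \<open>k\<close>-th vertex of part \<open>p\<close>; the list gives the part sizes.\<close>

definition complete_multipartite_graph :: "nat list \<Rightarrow> (nat \<times> nat) pair_pre_digraph" where
  "complete_multipartite_graph ns = (let V = {(p, k). p < length ns \<and> k < ns ! p} in
     \<lparr> pverts = V, parcs = {(x, y). x \<in> V \<and> y \<in> V \<and> fst x \<noteq> fst y} \<rparr>)"

end

theory Submission
  imports Defs
begin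

text \<open>
  On a \<open>k\<close>-regular graph with adjacency matrix \<open>A\<close>, let \<open>f\<^sub>n(x)\<close> be the total amplitude on the arcs
  into \<open>x\<close> after \<open>n\<close> steps from \<open>\<Phi>\<^sub>u\<close>. Then \<open>f\<^sub>n = T\<^sub>n(A / k) f\<^sub>0\<close> for the Chebyshev polynomials \<open>T\<^sub>n\<close>, so on a
  distance-regular graph \<open>f\<^sub>n\<close> is constant on the spheres around \<open>u\<close>. State transfer to \<open>v\<close> makes \<open>v\<close>
  the only vertex of its sphere; in diameter 2 every vertex then has a unique antipode and \<open>G\<close> is a
  cocktail party graph, with eigenvalues \<open>k\<close>, 0, \<open>-2\<close>. The eigenvalues \<open>k\<close> and \<open>-2\<close> give
  \<open>T\<^sub>\<tau>(-2 / k) = T\<^sub>\<tau>(1) = 1\<close>. As \<open>2 T\<^sub>\<tau>(x / 2)\<close> is a monic integer polynomial in \<open>x\<close>, the rational number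
  \<open>-4 / k\<close> is an integer, whence \<open>k\<close> is 2 or 4. Conversely the walk transfers
  in 2 steps on \<open>C\<^sub>4\<close> and in 6 steps on \<open>K\<^bsub>2,2,2\<^esub>\<close>.
\<close>

section \<open>The Grover walk on a regular graph\<close>

lemma of_real_sqrt_mult_self:
  "complex_of_real (sqrt (real k)) * complex_of_real (sqrt (real k)) = of_nat k"
  by (metis of_real_mult of_real_of_nat_eq real_sqrt_mult_self abs_of_nat)

lemma mat_vec_prod_mat_prod:
  "mat_vec_prod J (mat_prod K A B) x i = mat_vec_prod K A (mat_vec_prod J B x) i"
proof -
  have "mat_vec_prod J (mat_prod K A B) x i = (\<Sum>j\<in>J. \<Sum>k\<in>K. A i k * B k j * x j)"
    by (simp add: mat_vec_prod_def mat_prod_def sum_distrib_right)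
  also have "\<dots> = (\<Sum>k\<in>K. \<Sum>j\<in>J. A i k * B k j * x j)"
    by (rule sum.swap)
  also have "\<dots> = mat_vec_prod K A (mat_vec_prod J B x) i"
    by (simp add: mat_vec_prod_def sum_distrib_left mult.assoc)
  finally show ?thesis .
qed

lemma mat_vec_prod_mat_id:
  assumes "finite I" "i \<in> I"
  shows "mat_vec_prod I mat_id x i = x i"
  using assms by (simp add: mat_vec_prod_def mat_id_def if_distrib[of "\<lambda>c. c * _"] cong: if_cong)

definition grover_walk :: "'a pair_pre_digraph \<Rightarrow> 'a \<Rightarrow> nat \<Rightarrow> 'a \<times> 'a \<Rightarrow> complex" where
  "grover_walk G u n =
     mat_vec_prod (parcs G) (mat_pow (parcs G) (grover_mat G) n) (vertex_state G u)"

definition neighbours :: "'a pair_pre_digraph \<Rightarrow> 'a \<Rightarrow> 'a set" where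
  "neighbours G x = {w. (w, x) \<in> parcs G}"

text \<open>On a \<open>k\<close>-regular graph this is \<open>sqrt k\<close> times the entry at
  \<open>x\<close> of the boundary matrix applied to the state after \<open>n\<close> steps.\<close>

definition inflow :: "'a pair_pre_digraph \<Rightarrow> 'a \<Rightarrow> nat \<Rightarrow> 'a \<Rightarrow> complex" where
  "inflow G u n x = (\<Sum>w\<in>neighbours G x. grover_walk G u n (w, x))"

locale regular_pair_graph = pair_graph +
  fixes k :: nat
  assumes card_neighbours: "x \<in> pverts G \<Longrightarrow> card (neighbours G x) = k"
    and degree_pos: "k > 0"
begin

lemma finite_neighbours: "finite (neighbours G x)"
  by (rule finite_subset[OF _ pair_finite_verts]) (auto simp: neighbours_def in_arcsD1)

lemma neighbours_commute: "w \<in> neighbours G x \<longleftrightarrow> x \<in> neighbours G w"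
  unfolding neighbours_def using pair_sym_arcs by (auto simp: symmetric_def dest: symD)

lemma in_arcs_eq_image: "in_arcs (with_proj G) x = (\<lambda>w. (w, x)) ` neighbours G x"
  by (auto simp: in_arcs_def neighbours_def)

lemma in_degree_eq: "x \<in> pverts G \<Longrightarrow> in_degree (with_proj G) x = k"
  by (simp add: in_degree_def in_arcs_eq_image card_image inj_on_def card_neighbours)

lemma sum_in_arcs:
  "(\<Sum>b\<in>parcs G. if snd b = x then f b else 0) = (\<Sum>w\<in>neighbours G x. f (w, x))"
proof -
  have "(\<Sum>b\<in>parcs G. if snd b = x then f b else 0) = sum f (in_arcs (with_proj G) x)"
    by (subst sum.inter_filter[symmetric]) (auto simp: in_arcs_def pair_finite_arcs)
  then show ?thesis
    by (simp add: in_arcs_eq_image sum.reindex inj_on_def)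
qed

text \<open>Two factors \<open>1 / sqrt k\<close> meet exactly when both arcs end at the same
  vertex, so this Gram matrix averages over the arcs into each vertex.\<close>

lemma boundary_gram:
  assumes "b \<in> parcs G" "c \<in> parcs G"
  shows "mat_prod (pverts G) (mat_adj (boundary_mat G)) (boundary_mat G) b c =
    (if snd c = snd b then 1 / of_nat k else 0)"
proof -
  note sq = of_real_sqrt_mult_self[of k]
  have "mat_prod (pverts G) (mat_adj (boundary_mat G)) (boundary_mat G) b c =
    (\<Sum>w\<in>pverts G. if w = snd b then (if snd c = snd b then 1 / of_nat k else 0) else 0)"
    unfolding mat_prod_def
    by (rule sum.cong) (auto simp: mat_adj_def boundary_mat_def in_degree_eq sq)
  then show ?thesis
    using assms pair_finite_verts arc_snd_in_verts by simp
qed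

text \<open>The coin replaces the amplitude on an arc into \<open>x\<close> by twice the mean over
  all arcs into \<open>x\<close> minus itself; the shift then moves the result for
  \<open>(y, x)\<close> onto \<open>(x, y)\<close>.\<close>

lemma grover_mat_apply:
  assumes "(x, y) \<in> parcs G"
  shows "mat_vec_prod (parcs G) (grover_mat G) f (x, y) =
    2 / of_nat k * (\<Sum>w\<in>neighbours G x. f (w, x)) - f (y, x)"
proof -
  let ?C = "\<lambda>a b. 2 * mat_prod (pverts G) (mat_adj (boundary_mat G)) (boundary_mat G) a b - mat_id a b"
  have yx: "(y, x) \<in> parcs G"
    using assms neighbours_commute by (auto simp: neighbours_def)
  have "mat_vec_prod (parcs G) (grover_mat G) f (x, y) = mat_vec_prod (parcs G) ?C f (y, x)"
  proof -
    have shift: "shift_mat (x, y) b * z = (if b = (y, x) then z else 0)" for b z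
      by (cases b) (auto simp: shift_mat_def)
    show ?thesis
      unfolding grover_mat_def mat_vec_prod_mat_prod
      by (subst mat_vec_prod_def) (use yx pair_finite_arcs in \<open>simp add: shift\<close>)
  qed
  also have "\<dots> = (\<Sum>b\<in>parcs G. 2 / of_nat k * (if snd b = x then f b else 0)
      - (if b = (y, x) then f b else 0))"
    unfolding mat_vec_prod_def
    by (rule sum.cong) (auto simp: boundary_gram[OF yx] mat_id_def algebra_simps)
  also have "\<dots> = 2 / of_nat k * (\<Sum>w\<in>neighbours G x. f (w, x)) - f (y, x)"
    using yx by (simp only: sum_subtractf sum_in_arcs flip: sum_distrib_left)
      (simp add: pair_finite_arcs)
  finally show ?thesis .
qed

lemma vertex_state_eq:
  assumes "u \<in> pverts G"
  shows "vertex_state G u a = (if snd a = u then 1 / of_real (sqrt (real k)) else 0)"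
proof -
  have "vertex_state G u a = (\<Sum>w\<in>pverts G. if w = u then cnj (boundary_mat G u a) else 0)"
    unfolding vertex_state_def mat_vec_prod_def mat_adj_def by (rule sum.cong) auto
  then show ?thesis
    using assms pair_finite_verts by (simp add: boundary_mat_def in_degree_eq)
qed

lemma grover_walk_0:
  assumes "u \<in> pverts G" "a \<in> parcs G"
  shows "grover_walk G u 0 a = (if snd a = u then 1 / of_real (sqrt (real k)) else 0)"
  using assms by (simp add: grover_walk_def mat_vec_prod_mat_id pair_finite_arcs vertex_state_eq)

lemma grover_walk_Suc:
  assumes "(x, y) \<in> parcs G"
  shows "grover_walk G u (Suc n) (x, y) = 2 / of_nat k * inflow G u n x - grover_walk G u n (y, x)"
  using assms by (simp add: grover_walk_def inflow_def mat_vec_prod_mat_prod grover_mat_apply)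

text \<open>Reflection in the mean preserves the sum: \<open>k\<close> terms \<open>2 / k\<close>
  times the inflow give it twice, and subtracting the old amplitudes leaves it once.\<close>

lemma outflow_Suc:
  assumes "x \<in> pverts G"
  shows "(\<Sum>y\<in>neighbours G x. grover_walk G u (Suc n) (x, y)) = inflow G u n x"
proof -
  have "(\<Sum>y\<in>neighbours G x. grover_walk G u (Suc n) (x, y)) =
    (\<Sum>y\<in>neighbours G x. 2 / of_nat k * inflow G u n x - grover_walk G u n (y, x))"
    by (intro sum.cong grover_walk_Suc) (auto simp: neighbours_commute[of _ x], auto simp: neighbours_def)
  then show ?thesis
    using degree_pos by (simp add: sum_subtractf card_neighbours[OF assms]) (simp add: inflow_def)
qed

lemma inflow_Suc:
  "inflow G u (Suc n) x = 2 / of_nat k * (\<Sum>y\<in>neighbours G x. inflow G u n y)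
     - (\<Sum>y\<in>neighbours G x. grover_walk G u n (x, y))"
  unfolding inflow_def[of _ _ "Suc n"] sum_distrib_left
  by (simp add: neighbours_def grover_walk_Suc flip: sum_subtractf)

text \<open>Replacing the outflow by the inflow one step earlier turns \<open>inflow_Suc\<close>
  into the three-term Chebyshev recurrence at \<open>A / k\<close>, where \<open>A\<close> is the
  adjacency matrix.\<close>

lemma inflow_Suc_Suc:
  assumes "x \<in> pverts G"
  shows "inflow G u (Suc (Suc n)) x =
    2 / of_nat k * (\<Sum>y\<in>neighbours G x. inflow G u (Suc n) y) - inflow G u n x"
  using assms by (subst inflow_Suc) (simp add: outflow_Suc)

lemma inflow_0:
  assumes "u \<in> pverts G" "x \<in> pverts G"
  shows "inflow G u 0 x = (if x = u then of_real (sqrt (real k)) else 0)"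
proof -
  have "inflow G u 0 x = (\<Sum>w\<in>neighbours G x. if x = u then 1 / of_real (sqrt (real k)) else 0)"
    unfolding inflow_def using assms by (intro sum.cong) (auto simp: grover_walk_0 neighbours_def)
  also have "\<dots> = (if x = u then of_real (real k / sqrt (real k)) else 0)"
    by (simp add: card_neighbours[OF assms(2)])
  finally show ?thesis by (simp add: real_div_sqrt)
qed

text \<open>This is the second starting value, \<open>T_1(A / k)\<close> applied to the first:
  \<open>2 / k * sqrt k - 1 / sqrt k = 1 / sqrt k\<close>.\<close>

lemma inflow_1:
  assumes "u \<in> pverts G" "x \<in> pverts G"
  shows "inflow G u (Suc 0) x = (if x \<in> neighbours G u then 1 / of_real (sqrt (real k)) else 0)"
proof -
  note sq = of_real_sqrt_mult_self[of k]
  have "(\<Sum>y\<in>neighbours G x. inflow G u 0 y) =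
      (\<Sum>y\<in>neighbours G x. if y = u then of_real (sqrt (real k)) else 0)"
    using assms by (intro sum.cong) (auto simp: inflow_0 neighbours_def in_arcsD1)
  moreover have "(\<Sum>y\<in>neighbours G x. grover_walk G u 0 (x, y)) =
      (\<Sum>y\<in>neighbours G x. if y = u then 1 / of_real (sqrt (real k)) else 0)"
    using assms by (intro sum.cong refl)
      (auto simp: neighbours_commute[of _ x], auto simp: neighbours_def grover_walk_0)
  ultimately show ?thesis
    using degree_pos sq
    by (subst inflow_Suc) (auto simp: finite_neighbours neighbours_commute[of u] field_simps)
qed

text \<open>Inflow is linear in the state, and the state of \<open>v\<close> flows only into
  \<open>v\<close>.\<close>

lemma inflow_perfect_state_transfer:
  assumes "v \<in> pverts G" "x \<in> pverts G"
    and "\<And>a. a \<in> parcs G \<Longrightarrow> grover_walk G u n a = \<gamma> * vertex_state G v a"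
  shows "inflow G u n x = (if x = v then \<gamma> * of_real (sqrt (real k)) else 0)"
proof -
  have "inflow G u n x = \<gamma> * inflow G v 0 x"
    unfolding inflow_def sum_distrib_left using assms
    by (intro sum.cong) (auto simp: grover_walk_0 vertex_state_eq neighbours_def)
  then show ?thesis using assms by (simp add: inflow_0)
qed

end

section \<open>Cocktail party graphs\<close>

text \<open>Regularity of degree \<open>k\<close> on \<open>k + 2\<close> vertices leaves each
  vertex exactly one other non-neighbour, its antipode; the complement is a perfect
  matching.\<close>

locale cocktail_party_graph = regular_pair_graph +
  assumes card_verts: "card (pverts G) = k + 2"
begin

lemma neighbours_subset: "neighbours G x \<subseteq> pverts G - {x}"
  using no_loops' in_arcsD1 by (auto simp: neighbours_def)

lemma antipodeE:
  assumes "x \<in> pverts G"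
  obtains x' where "x' \<in> pverts G" "x' \<noteq> x" "neighbours G x = pverts G - {x, x'}"
proof -
  have "card (pverts G - {x} - neighbours G x) = 1"
    using assms neighbours_subset[of x] card_verts
    by (simp add: card_Diff_subset finite_neighbours card_neighbours pair_finite_verts)
  then obtain x' where x': "pverts G - {x} - neighbours G x = {x'}"
    by (auto simp: card_1_singleton_iff)
  then have "neighbours G x = pverts G - {x, x'}"
    using neighbours_subset[of x] by blast
  with x' that show thesis by blast
qed

text \<open>Non-adjacency is symmetric, and \<open>x'\<close> has only one non-neighbour besides
  itself.\<close>

lemma antipode_commute:
  assumes "x \<in> pverts G" "x' \<in> pverts G" "x' \<noteq> x" "neighbours G x = pverts G - {x, x'}"
  shows "neighbours G x' = pverts G - {x', x}"
proof -
  obtain y where y: "y \<in> pverts G" "y \<noteq> x'" "neighbours G x' = pverts G - {x', y}"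
    using assms(2) by (rule antipodeE)
  have "x \<notin> neighbours G x'"
    using assms neighbours_commute[of x x'] by auto
  then show ?thesis using y assms by auto
qed

text \<open>Neither \<open>u\<close> nor \<open>v\<close> is the antipode of \<open>m\<close>, so
  both are adjacent to it; the other \<open>k - 2\<close> neighbours all carry the value
  \<open>c\<close>.\<close>

lemma sum_neighbours:
  fixes f :: "'a \<Rightarrow> complex"
  assumes uv: "u \<in> pverts G" "v \<in> pverts G" "u \<noteq> v" "neighbours G u = pverts G - {u, v}"
    and m: "m \<in> pverts G" "m \<noteq> u" "m \<noteq> v"
    and f: "\<And>x. x \<in> pverts G \<Longrightarrow> x \<noteq> u \<Longrightarrow> x \<noteq> v \<Longrightarrow> x \<noteq> m \<Longrightarrow> f x = c"
  shows "(\<Sum>w\<in>neighbours G m. f w) = f u + f v + (of_nat k - 2) * c"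
proof -
  have v: "neighbours G v = pverts G - {v, u}"
    using antipode_commute[of u v] uv by simp
  obtain m' where m': "m' \<in> pverts G" "m' \<noteq> m" "neighbours G m = pverts G - {m, m'}"
    using m(1) by (rule antipodeE)
  have um: "u \<in> neighbours G m" "v \<in> neighbours G m"
    using neighbours_commute[of m] uv m v by auto
  have "card (neighbours G m - {u, v}) = k - 2" and "k \<ge> 2"
    using um uv card_neighbours[OF m(1)] finite_neighbours[of m] card_mono[of "neighbours G m" "{u, v}"]
    by (auto simp: card_Diff_subset)
  moreover have "(\<Sum>w\<in>neighbours G m. f w) = f u + f v + (\<Sum>w\<in>neighbours G m - {u, v}. f w)"
  proof -
    have "neighbours G m = insert u (insert v (neighbours G m - {u, v}))" using um by auto
    then show ?thesis using uv(3) finite_neighbours[of m]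
      by (metis (no_types, lifting) Diff_iff add.assoc finite_Diff finite_insert insertE insertI1 insertI2
          singletonD sum.insert)
  qed
  moreover have "(\<Sum>w\<in>neighbours G m - {u, v}. f w) = (\<Sum>w\<in>neighbours G m - {u, v}. c)"
    using m' by (intro sum.cong f) auto
  ultimately show ?thesis by (simp add: of_nat_diff)
qed

end

section \<open>Integrality of Chebyshev values at rational arguments\<close>

text \<open>This is \<open>2 q\<^sup>n T\<^sub>n(p / (2 q))\<close>, which is congruent to \<open>p\<^sup>n\<close> modulo \<open>q\<close>.\<close>

fun scaled_chebyshev :: "int \<Rightarrow> int \<Rightarrow> nat \<Rightarrow> int" where
  "scaled_chebyshev p q 0 = 2"
| "scaled_chebyshev p q (Suc 0) = p"
| "scaled_chebyshev p q (Suc (Suc n)) =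
     p * scaled_chebyshev p q (Suc n) - q\<^sup>2 * scaled_chebyshev p q n"

text \<open>Modulo \<open>q\<close> the last term of the recurrence vanishes, so each step
  multiplies by \<open>p\<close>. The index starts at 1 because the value at 0 is 2 and not
  \<open>p ^ 0\<close>.\<close>

lemma scaled_chebyshev_cong: "q dvd scaled_chebyshev p q (Suc n) - p ^ Suc n"
proof (induction n)
  case (Suc n)
  have "scaled_chebyshev p q (Suc (Suc n)) - p ^ Suc (Suc n) =
      p * (scaled_chebyshev p q (Suc n) - p ^ Suc n) - q * (q * scaled_chebyshev p q n)"
    by (simp add: algebra_simps power2_eq_square)
  then show ?case using Suc by (simp only: dvd_diff dvd_mult dvd_triv_left)
qed simp

text \<open>The hypotheses amount to \<open>s n = c * T_n(p / (2 q))\<close>; the factor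
  \<open>2 q ^ n\<close> clears all denominators.\<close>

lemma scaled_chebyshev_of_ratio:
  fixes s :: "nat \<Rightarrow> complex"
  assumes "s 0 = c" "s (Suc 0) = of_int p / (2 * of_int q) * c" "q \<noteq> 0"
    and "\<And>n. s (Suc (Suc n)) = of_int p / of_int q * s (Suc n) - s n"
  shows "2 * of_int q ^ n * s n = of_int (scaled_chebyshev p q n) * c"
proof (induction n rule: induct_nat_012)
  case (ge2 n)
  have "2 * of_int q ^ Suc (Suc n) * s (Suc (Suc n)) =
      of_int p * (2 * of_int q ^ Suc n * s (Suc n)) - (of_int q)\<^sup>2 * (2 * of_int q ^ n * s n)"
    using assms(3) by (simp add: assms(4) power2_eq_square algebra_simps)
  also have "\<dots> = of_int (scaled_chebyshev p q (Suc (Suc n))) * c"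
    unfolding ge2.IH by (simp add: algebra_simps)
  finally show ?case .
qed (use assms in \<open>auto simp: field_simps\<close>)

text \<open>This is the rational root argument: reducing the equation modulo \<open>q\<close> gives
  \<open>q dvd p ^ n\<close>, which coprimality allows only for a unit.\<close>

lemma scaled_chebyshev_eq_imp_unit:
  assumes "coprime p q" "n > 0" "scaled_chebyshev p q n = 2 * q ^ n"
  shows "q dvd 1"
proof -
  obtain m where m: "n = Suc m" using assms(2) by (cases n) auto
  have "q dvd 2 * q ^ n - p ^ n"
    using scaled_chebyshev_cong[of q p m] assms(3) m by simp
  moreover have "q dvd 2 * q ^ n" using m by simp
  ultimately have "q dvd p ^ n"
    using dvd_diff[of q "2 * q ^ n" "2 * q ^ n - p ^ n"] by simp
  moreover have "coprime q (p ^ n)" using assms(1) by (simp add: coprime_commute)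
  ultimately show ?thesis by (meson coprime_common_divisor dvd_refl)
qed

section \<open>State transfer between antipodes and the degree\<close>

context cocktail_party_graph
begin

text \<open>The recurrence at a neighbour \<open>z\<close> of \<open>u\<close> sees only
  \<open>u\<close>, \<open>v\<close> and \<open>k - 2\<close> vertices that share one inflow by
  induction, so its result does not depend on \<open>z\<close>.\<close>

lemma inflow_eq_off_antipodes:
  assumes uv: "u \<in> pverts G" "v \<in> pverts G" "u \<noteq> v" "neighbours G u = pverts G - {u, v}"
    and m: "m \<in> neighbours G u" and x: "x \<in> neighbours G u"
  shows "inflow G u n x = inflow G u n m"
  using x
proof (induction n arbitrary: x rule: induct_nat_012)
  case 0
  then show ?case using assms by (auto simp: inflow_0)
next
  case 1
  then show ?case using assms by (auto simp: inflow_1)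
next
  case (ge2 n)
  have "(\<Sum>y\<in>neighbours G z. inflow G u (Suc n) y) =
      inflow G u (Suc n) u + inflow G u (Suc n) v + (of_nat k - 2) * inflow G u (Suc n) m"
    if "z \<in> neighbours G u" for z
    using that uv by (intro sum_neighbours ge2.IH(2)) auto
  then show ?case
    using ge2.prems ge2.IH(1)[OF ge2.prems] m uv(4) by (simp add: inflow_Suc_Suc)
qed

text \<open>The eigenvectors of the adjacency matrix that are constant on the antipodal pair
  \<open>{u, v}\<close> and on the remaining vertices have the eigenvalues \<open>k\<close> and \<open>-2\<close>. The first one forces the
  phase to be 1, the second one then forces \<open>-4 / k\<close> to be an integer.\<close>

lemma degree_dvd_4:
  assumes uv: "u \<in> pverts G" "v \<in> pverts G" "u \<noteq> v" "neighbours G u = pverts G - {u, v}"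
    and \<tau>: "\<tau> > 0"
    and pst: "\<And>x. x \<in> pverts G \<Longrightarrow>
      inflow G u \<tau> x = (if x = v then \<gamma> * of_real (sqrt (real k)) else 0)"
  shows "k dvd 4"
proof -
  define c where "c = complex_of_real (sqrt (real k))"
  have c: "c * c = of_nat k" "c \<noteq> 0"
    using degree_pos by (simp_all add: c_def of_real_sqrt_mult_self)
  have k0: "complex_of_nat k \<noteq> 0" using degree_pos by simp
  have v: "neighbours G v = pverts G - {v, u}"
    using antipode_commute[of u v] uv by simp
  have "neighbours G u \<noteq> {}" using card_neighbours[OF uv(1)] degree_pos by auto
  then obtain m where m: "m \<in> neighbours G u" by blast
  then have m': "m \<in> pverts G" "m \<noteq> u" "m \<noteq> v" using uv by auto
  have off: "inflow G u n x = inflow G u n m" if "x \<in> neighbours G u" for n x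
    using inflow_eq_off_antipodes[OF uv m] that by blast
  have sum_u: "(\<Sum>y\<in>neighbours G u. inflow G u n y) = of_nat k * inflow G u n m" for n
    using off card_neighbours[OF uv(1)] by simp
  have sum_v: "(\<Sum>y\<in>neighbours G v. inflow G u n y) = of_nat k * inflow G u n m" for n
    using sum_u[of n] uv v by (simp add: insert_commute)
  have sum_m: "(\<Sum>y\<in>neighbours G m. inflow G u n y) =
      inflow G u n u + inflow G u n v + (of_nat k - 2) * inflow G u n m" for n
    using uv m' by (intro sum_neighbours off) auto
  note rec = inflow_Suc_Suc[OF uv(1)] inflow_Suc_Suc[OF uv(2)] inflow_Suc_Suc[OF m'(1)]
  \<comment> \<open>The coefficients \<open>(1, 1, -2)\<close> and \<open>(1, 1, k)\<close> on the
    values at \<open>u\<close>, \<open>v\<close>, \<open>m\<close> are left eigenvectors, for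
    \<open>-2\<close> and \<open>k\<close>, of the quotient of the adjacency matrix. Hence
    \<open>s\<close> and \<open>t\<close> obey scalar Chebyshev recurrences.\<close>
  define s where "s n = inflow G u n u + inflow G u n v - 2 * inflow G u n m" for n
  define t where "t n = inflow G u n u + inflow G u n v + of_nat k * inflow G u n m" for n
  have un: "u \<notin> neighbours G u" "v \<notin> neighbours G u" using uv by auto
  \<comment> \<open>The argument is \<open>k / k = 1\<close>, where every \<open>T_n\<close> equals
    1. Two consecutive values are carried because the recurrence has order two.\<close>
  have t: "t n = c \<and> t (Suc n) = c" for n
  proof (induction n)
    case 0
    then show ?case
      using uv m m' un c by (simp add: t_def inflow_0 inflow_1 flip: c_def) (simp add: field_simps)
  next
    case (Suc n)
    have "t (Suc (Suc n)) = 2 * t (Suc n) - t n"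
      using k0 by (simp add: t_def rec sum_u sum_v sum_m field_simps)
    then show ?case using Suc by simp
  qed
  \<comment> \<open>At the transfer time only \<open>v\<close> has inflow, so the constant value of
    \<open>t\<close> fixes the phase.\<close>
  have "\<gamma> * c = t \<tau>"
    using uv m' by (simp add: t_def pst c_def)
  with t c have \<gamma>: "\<gamma> = 1" by simp
  have s\<tau>: "s \<tau> = c"
    using uv m' by (simp add: s_def pst \<gamma> c_def)

  \<comment> \<open>Next \<open>-4 / k\<close>, twice the argument \<open>-2 / k\<close> belonging
    to \<open>s\<close>, is put in lowest terms \<open>p / q\<close>.\<close>
  define g where "g = gcd 4 k"
  have g: "k = g * (k div g)" "4 = g * (4 div g)"
    by (simp_all add: g_def)
  then have "g > 0" "k div g > 0"
    using degree_pos by (metis mult_0 mult_0_right neq0_conv)+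
  note g = this g
  define q where "q = int (k div g)"
  define p where "p = - int (4 div g)"
  have "coprime (4 div g) (k div g)"
    unfolding g_def using degree_pos by (intro div_gcd_coprime) auto
  then have cop: "coprime p q" by (simp add: p_def q_def)
  have q0: "q \<noteq> 0" using g(2) by (simp add: q_def)
  have pq: "complex_of_int p / of_int q = - 4 / of_nat k"
  proof -
    have "complex_of_nat 4 / of_nat k = of_nat (4 div g) / of_nat (k div g)"
      using g mult_divide_mult_cancel_left[of "of_nat g" "complex_of_nat (4 div g)" "of_nat (k div g)"]
      by (metis of_nat_eq_0_iff of_nat_mult less_irrefl)
    then show ?thesis by (simp add: p_def q_def)
  qed
  have "2 * of_int q ^ \<tau> * s \<tau> = of_int (scaled_chebyshev p q \<tau>) * c"
  proof (rule scaled_chebyshev_of_ratio)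
    show "s 0 = c" using uv m' un by (simp add: s_def inflow_0 c_def)
    have "s (Suc 0) = - (2 / c)" using uv m m' un by (simp add: s_def inflow_1 c_def)
    also have "\<dots> = of_int p / of_int q / 2 * c"
      unfolding pq using c k0 by (simp add: field_simps)
    finally show "s (Suc 0) = of_int p / (2 * of_int q) * c"
      by (simp add: mult.commute)
    show "s (Suc (Suc n)) = of_int p / of_int q * s (Suc n) - s n" for n
      unfolding pq using k0 by (simp add: s_def rec sum_u sum_v sum_m field_simps)
  qed (rule q0)
  then have "complex_of_int (scaled_chebyshev p q \<tau>) = of_int (2 * q ^ \<tau>)"
    using s\<tau> c by simp
  then have "scaled_chebyshev p q \<tau> = 2 * q ^ \<tau>" by (simp only: of_int_eq_iff)
  then have "q dvd 1" using scaled_chebyshev_eq_imp_unit cop \<tau> by blast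
  then have "k div g = 1" by (simp add: q_def)
  then have "k = g" using g(3) by (metis mult_1_right)
  then show ?thesis by (metis g_def gcd_dvd1)
qed

section \<open>The explicit walk between antipodes for degrees 2 and 4\<close>

text \<open>The five values are those on the arcs into \<open>u\<close>, out of \<open>u\<close>, into \<open>v\<close>, out of \<open>v\<close>, and
  between the remaining vertices.\<close>

definition walk_profile ::
    "'a \<Rightarrow> 'a \<Rightarrow> nat \<Rightarrow> complex \<Rightarrow> complex \<Rightarrow> complex \<Rightarrow> complex \<Rightarrow> complex \<Rightarrow> bool" where
  "walk_profile u v n a b c d e \<longleftrightarrow> (\<forall>x y. (x, y) \<in> parcs G \<longrightarrow>
     grover_walk G u n (x, y) = 1 / of_real (sqrt (real k)) *
       (if y = u then a else if x = u then b else if y = v then c else if x = v then d else e))"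

lemma walk_profile_0:
  assumes "u \<in> pverts G"
  shows "walk_profile u v 0 1 0 0 0 0"
  using assms by (simp add: walk_profile_def grover_walk_0)

text \<open>Arcs out of \<open>u\<close> and \<open>v\<close> inherit the uniform incoming
  amplitudes \<open>a\<close> and \<open>c\<close>. In units of \<open>1 / sqrt k\<close>,
  \<open>f\<close> is twice the mean amplitude on the arcs into a remaining vertex.\<close>

lemma walk_profile_Suc:
  assumes uv: "u \<in> pverts G" "v \<in> pverts G" "u \<noteq> v" "neighbours G u = pverts G - {u, v}"
    and wp: "walk_profile u v n a b c d e"
    and f: "f = 2 / of_nat k * (b + d + (of_nat k - 2) * e)"
  shows "walk_profile u v (Suc n) (f - b) a (f - d) c (f - e)"
  unfolding walk_profile_def
proof (intro allI impI)
  fix x y assume xy: "(x, y) \<in> parcs G"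
  define r where "r = 1 / complex_of_real (sqrt (real k))"
  have v: "neighbours G v = pverts G - {v, u}"
    using antipode_commute[of u v] uv by simp
  have yx: "(y, x) \<in> parcs G"
    using xy neighbours_commute by (auto simp: neighbours_def)
  have verts: "x \<in> pverts G" "y \<in> pverts G" "x \<noteq> y"
    using xy in_arcsD1 in_arcsD2 no_loops' by auto
  have nadj: "\<not> (x = u \<and> y = v)" "\<not> (x = v \<and> y = u)"
    using uv(4) v xy yx by (auto simp: neighbours_def)
  note walk = wp[unfolded walk_profile_def, rule_format, folded r_def]
  have k0: "complex_of_nat k \<noteq> 0" using degree_pos by simp
  have "inflow G u n x = r * (if x = u then of_nat k * a else if x = v then of_nat k * c
      else b + d + (of_nat k - 2) * e)"
  proof -
    consider "x = u" | "x = v" | "x \<noteq> u" "x \<noteq> v" by blast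
    then show ?thesis
    proof cases
      case 1
      then have "inflow G u n x = (\<Sum>w\<in>neighbours G x. r * a)"
        unfolding inflow_def by (intro sum.cong) (auto simp: neighbours_def walk)
      with 1 show ?thesis using card_neighbours[OF uv(1)] by simp
    next
      case 2
      then have "inflow G u n x = (\<Sum>w\<in>neighbours G x. r * c)"
        unfolding inflow_def using uv(3) v
        by (intro sum.cong refl) (subst walk, auto simp: neighbours_def)
      with 2 show ?thesis using card_neighbours[OF uv(2)] uv(3) by simp
    next
      case 3
      define h where "h w = r * (if w = u then b else if w = v then d else e)" for w
      have "inflow G u n x = (\<Sum>w\<in>neighbours G x. h w)"
        unfolding inflow_def using 3 by (intro sum.cong) (auto simp: neighbours_def walk h_def)
      also have "\<dots> = h u + h v + (of_nat k - 2) * (r * e)"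
        using uv verts(1) 3 by (intro sum_neighbours) (auto simp: h_def)
      finally show ?thesis using 3 uv(3) by (simp add: h_def algebra_simps)
    qed
  qed
  then have "2 / of_nat k * inflow G u n x = r * (if x = u then 2 * a else if x = v then 2 * c else f)"
    using k0 by (simp add: f)
  then have walk_Suc: "grover_walk G u (Suc n) (x, y) =
      r * ((if x = u then 2 * a else if x = v then 2 * c else f) -
        (if x = u then a else if y = u then b else if x = v then c else if y = v then d else e))"
    by (simp only: grover_walk_Suc[OF xy] walk[OF yx] right_diff_distrib)
  \<comment> \<open>The two conditionals test heads and tails in different orders; they agree
    because an arc has distinct ends and never joins \<open>u\<close> and \<open>v\<close>.\<close>
  have eq: "(if x = u then 2 * a else if x = v then 2 * c else f) -
        (if x = u then a else if y = u then b else if x = v then c else if y = v then d else e) =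
      (if y = u then f - b else if x = u then a else if y = v then f - d
       else if x = v then c else f - e)"
  proof -
    consider "x = u" "y \<noteq> u" "y \<noteq> v" | "x = v" "x \<noteq> u" "y \<noteq> u" "y \<noteq> v"
      | "x \<noteq> u" "x \<noteq> v"
      using verts(3) nadj uv(3) by blast
    then show ?thesis
      by cases simp_all
  qed
  show "grover_walk G u (Suc n) (x, y) = 1 / of_real (sqrt (real k)) *
      (if y = u then f - b else if x = u then a else if y = v then f - d
       else if x = v then c else f - e)"
    unfolding walk_Suc eq r_def ..
qed

text \<open>The profile \<open>0 0 1 0 0\<close> is the state of \<open>v\<close>. For
  \<open>k = 2\<close> any \<open>e\<close> will do: an arc avoiding both \<open>u\<close> and
  \<open>v\<close> would give its head three neighbours.\<close>

lemma perfect_state_transferI: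
  assumes uv: "u \<in> pverts G" "v \<in> pverts G" "u \<noteq> v" "neighbours G u = pverts G - {u, v}"
    and "walk_profile u v \<tau> 0 0 1 0 e" "\<tau> > 0" "e = 0 \<or> k = 2"
  shows "perfect_state_transfer G"
proof -
  have v: "neighbours G v = pverts G - {v, u}"
    using antipode_commute[of u v] uv by simp
  have "grover_walk G u \<tau> (x, y) = 1 * vertex_state G v (x, y)" if xy: "(x, y) \<in> parcs G" for x y
  proof -
    have "x = u \<or> y = u \<or> x = v \<or> y = v" if "k = 2"
    proof (rule ccontr)
      assume neg: "\<not> (x = u \<or> y = u \<or> x = v \<or> y = v)"
      have "y \<in> pverts G" using xy in_arcsD2 by auto
      then have "{u, v, x} \<subseteq> neighbours G y"
        using neighbours_commute[of _ y] uv v xy neg by (auto simp: neighbours_def)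
      moreover have "card {u, v, x} = 3" using uv(3) neg by auto
      ultimately show False
        using card_mono[OF finite_neighbours[of y], of "{u, v, x}"] card_neighbours[OF \<open>y \<in> pverts G\<close>] that
        by simp
    qed
    moreover have "u \<notin> neighbours G v" using v by auto
    then have "\<not> (x = u \<and> y = v)" using xy by (auto simp: neighbours_def)
    moreover have "grover_walk G u \<tau> (x, y) = 1 / of_real (sqrt (real k)) *
        (if y = u then 0 else if x = u then 0 else if y = v then 1 else if x = v then 0 else e)"
      using assms(5) xy by (simp add: walk_profile_def)
    ultimately show ?thesis
      using assms(7) uv(3) by (auto simp: vertex_state_eq[OF uv(2)])
  qed
  then show ?thesis
    using uv(1-3) assms(6) unfolding perfect_state_transfer_def grover_walk_def
    by (intro bexI[of _ u] bexI[of _ v] exI[of _ \<tau>] exI[of _ 1]) auto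
qed

text \<open>At time 2 for \<open>k = 2\<close> and time 6 for \<open>k = 4\<close>,
  \<open>T_n\<close> is 1 at \<open>1\<close> and at \<open>-2 / k\<close> but -1 at
  \<open>0\<close>, which exchanges antipodes.\<close>

lemma perfect_state_transfer_if_degree:
  assumes "k = 2 \<or> k = 4"
  shows "perfect_state_transfer G"
proof -
  obtain u where u: "u \<in> pverts G"
    using card_verts by fastforce
  then obtain v where v: "v \<in> pverts G" "v \<noteq> u" "neighbours G u = pverts G - {u, v}"
    by (rule antipodeE)
  note uv = u v(1) v(2)[symmetric] v(3)
  note step = walk_profile_Suc[OF uv]
  from assms show ?thesis
  proof
    assume k: "k = 2"
    have "walk_profile u v (Suc 0) 0 1 0 0 0"
      using step[OF walk_profile_0[OF u] refl] by simp
    \<comment> \<open>The final 1 belongs to arcs that do not exist when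
      \<open>k = 2\<close>.\<close>
    then have "walk_profile u v 2 0 0 1 0 1"
      using step[of 1 0 1 0 0 0 1] k by (simp add: numeral_2_eq_2)
    then show ?thesis using perfect_state_transferI[OF uv] k by simp
  next
    assume k: "k = 4"
    \<comment> \<open>With \<open>2 / k = 1/2\<close>, the successive values of \<open>f\<close> are
      0, 1/2, 1/2, 0, 1/2, 1/2.\<close>
    have "walk_profile u v 1 0 1 0 0 0"
      using step[OF walk_profile_0[OF u] refl] by simp
    then have "walk_profile u v 2 (-1/2) 0 (1/2) 0 (1/2)"
      using step[of 1 0 1 0 0 0 "1/2"] k by (simp add: numeral_2_eq_2)
    then have "walk_profile u v 3 (1/2) (-1/2) (1/2) (1/2) 0"
      using step[of 2 "-1/2" 0 "1/2" 0 "1/2" "1/2"] k by simp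
    then have "walk_profile u v 4 (1/2) (1/2) (-1/2) (1/2) 0"
      using step[of 3 "1/2" "-1/2" "1/2" "1/2" 0 0] k by simp
    then have "walk_profile u v 5 0 (1/2) 0 (-1/2) (1/2)"
      using step[of 4 "1/2" "1/2" "-1/2" "1/2" 0 "1/2"] k by simp
    then have "walk_profile u v 6 0 0 1 0 0"
      using step[of 5 0 "1/2" 0 "-1/2" "1/2" "1/2"] k by simp
    then show ?thesis using perfect_state_transferI[OF uv] by simp
  qed
qed

end

section \<open>Distance-regular graphs of diameter 2\<close>

locale distance_regular_diameter_2 = pair_graph +
  assumes dist_regular: "distance_regular G"
    and diameter: "graph_diameter G = 2"
begin

text \<open>In diameter 2 the \<open>ereal\<close>-valued infimum \<open>graph_dist\<close> reduces
  to this function on vertices; see \<open>graph_dist_eq\<close>.\<close>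

definition ndist :: "'a \<Rightarrow> 'a \<Rightarrow> nat" where
  "ndist x y = (if x = y then 0 else if (x, y) \<in> parcs G then 1 else 2)"

lemma awalk_cost_one: "awalk_cost (\<lambda>_. 1) p = real (length p)"
  by (induction p) auto

lemma graph_dist_less_imp_awalk:
  assumes "graph_dist G x y < ereal r"
  obtains p where "awalk x p y" "real (length p) < r"
  using assms by (auto simp: graph_dist_def \<mu>_def INF_less_iff awalk_cost_one)

lemma graph_dist_le_awalk: "awalk x p y \<Longrightarrow> graph_dist G x y \<le> ereal (real (length p))"
  unfolding graph_dist_def using min_cost_le_walk_cost[of x p y "\<lambda>_. 1"]
  by (simp add: awalk_cost_one)

text \<open>The diameter gives the upper bound 2; a walk shorter than claimed would make the ends
  equal or adjacent.\<close>

lemma graph_dist_eq: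
  assumes "x \<in> pverts G" "y \<in> pverts G"
  shows "graph_dist G x y = ereal (real (ndist x y))"
proof -
  have le2: "graph_dist G x y \<le> 2"
    unfolding diameter[symmetric] graph_diameter_def
    using assms by (intro SUP_upper2[of "(x, y)"]) auto
  have ge0: "graph_dist G x y \<ge> 0"
    unfolding graph_dist_def \<mu>_def by (intro INF_greatest) (simp add: awalk_cost_one)
  show ?thesis
  proof (cases "x = y")
    case True
    then show ?thesis
      using graph_dist_le_awalk[of x "[]" y] assms ge0
      by (simp add: ndist_def awalk_Nil_iff antisym zero_ereal_def)
  next
    case False
    have ge1: "graph_dist G x y \<ge> ereal 1"
    proof (rule ccontr)
      assume "\<not> ?thesis"
      then obtain p where "awalk x p y" "real (length p) < 1"
        by (meson graph_dist_less_imp_awalk not_le)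
      with False show False by (auto simp: awalk_Nil_iff)
    qed
    show ?thesis
    proof (cases "(x, y) \<in> parcs G")
      case True
      then have "awalk x [(x, y)] y" using assms by (simp add: awalk_simps)
      from graph_dist_le_awalk[OF this] show ?thesis
        using False True ge1 by (simp add: ndist_def antisym one_ereal_def)
    next
      case nadj: False
      have "graph_dist G x y \<ge> ereal 2"
      proof (rule ccontr)
        assume "\<not> ?thesis"
        then obtain p where p: "awalk x p y" "real (length p) < 2"
          by (meson graph_dist_less_imp_awalk not_le)
        then have "length p = 0 \<or> length p = 1" by linarith
        with p(1) False nadj show False
          by (auto simp: awalk_Nil_iff awalk_Cons_iff length_Suc_conv)
      qed
      then show ?thesis using False nadj le2 by (simp add: ndist_def antisym)
    qed
  qed
qed

lemma ndist_commute: "ndist x y = ndist y x"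
  using pair_sym_arcs by (auto simp: ndist_def symmetric_def dest: symD)

lemma ndist_le: "ndist x y \<le> 2"
  by (simp add: ndist_def)

lemma ndist_eq_0_iff: "ndist x y = 0 \<longleftrightarrow> x = y"
  by (simp add: ndist_def)

lemma neighbours_eq: "neighbours G x = {w \<in> pverts G. ndist x w = 1}"
proof -
  have "neighbours G x = {w \<in> pverts G. ndist w x = 1}"
    using in_arcsD1 no_loops' by (auto simp: neighbours_def ndist_def split: if_splits)
  then show ?thesis by (simp add: ndist_commute)
qed

lemma card_ndist:
  assumes "x \<in> pverts G" "y \<in> pverts G" "x' \<in> pverts G" "y' \<in> pverts G" "ndist x y = ndist x' y'"
  shows "card {w \<in> pverts G. ndist x w = i \<and> ndist y w = j} =
    card {w \<in> pverts G. ndist x' w = i \<and> ndist y' w = j}"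
proof -
  have eq: "{w \<in> pverts G. graph_dist G a w = i \<and> graph_dist G b w = j} =
      {w \<in> pverts G. ndist a w = i \<and> ndist b w = j}" if "a \<in> pverts G" "b \<in> pverts G" for a b
    using that by (auto simp: graph_dist_eq)
  have "graph_dist G x y = graph_dist G x' y'"
    using assms by (simp add: graph_dist_eq)
  with dist_regular assms have
    "card {w \<in> pverts G. graph_dist G x w = i \<and> graph_dist G y w = j} =
     card {w \<in> pverts G. graph_dist G x' w = i \<and> graph_dist G y' w = j}"
    unfolding distance_regular_def by blast
  then show ?thesis using assms by (simp add: eq)
qed

text \<open>If distance 2 did not occur, the supremum would be at most 1. A walk with fewer than
  three arcs between such a pair has exactly two, and its midpoint is a common neighbour.\<close>

lemma ex_ndist_2:
  obtains x y z where "x \<in> pverts G" "y \<in> pverts G" "ndist x y = 2"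
    "x \<in> neighbours G z" "y \<in> neighbours G z"
proof -
  have "\<exists>x\<in>pverts G. \<exists>y\<in>pverts G. ndist x y = 2"
  proof (rule ccontr)
    assume neg: "\<not> ?thesis"
    have "graph_dist G x y \<le> 1" if "x \<in> pverts G" "y \<in> pverts G" for x y
    proof -
      have "ndist x y \<le> 1" using that neg ndist_le[of x y] by force
      then show ?thesis using that by (simp add: graph_dist_eq one_ereal_def)
    qed
    then have "graph_diameter G \<le> 1"
      unfolding graph_diameter_def by (intro SUP_least) auto
    then show False by (simp add: diameter)
  qed
  then obtain x y where xy: "x \<in> pverts G" "y \<in> pverts G" "ndist x y = 2" by blast
  then have "graph_dist G x y < ereal 3" by (simp add: graph_dist_eq)
  then obtain p where p: "awalk x p y" "real (length p) < 3"
    by (rule graph_dist_less_imp_awalk)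
  then have "length p = 0 \<or> length p = 1 \<or> length p = 2" by linarith
  with p(1) xy(3) obtain z where "(x, z) \<in> parcs G" "(z, y) \<in> parcs G"
    by (auto simp: awalk_Nil_iff awalk_Cons_iff length_Suc_conv numeral_2_eq_2 ndist_def split: if_splits)
  then have "x \<in> neighbours G z" "y \<in> neighbours G z"
    using pair_sym_arcs by (auto simp: neighbours_def symmetric_def dest: symD)
  with xy that show thesis by blast
qed

text \<open>Regularity is the case of distance 0 with \<open>i = j = 1\<close>; the midpoint between
  two vertices at distance 2 has two neighbours, whence \<open>k \<ge> 2\<close>.\<close>

lemma regularE:
  obtains k where "regular_pair_graph G k" "k \<ge> 2"
proof -
  obtain x y z where xyz: "x \<in> pverts G" "y \<in> pverts G" "ndist x y = 2"
    "x \<in> neighbours G z" "y \<in> neighbours G z"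
    by (rule ex_ndist_2)
  have z: "z \<in> pverts G" using xyz in_arcsD2 by (auto simp: neighbours_def)
  have "x \<noteq> y" using xyz by (auto simp: ndist_def)
  then have "card {x, y} = 2" by simp
  moreover have "finite (neighbours G z)"
    using pair_finite_verts by (simp add: neighbours_eq)
  ultimately have "card (neighbours G z) \<ge> 2"
    using xyz card_mono[of "neighbours G z" "{x, y}"] by simp
  moreover have "card (neighbours G w) = card (neighbours G z)" if "w \<in> pverts G" for w
    using card_ndist[of w w z z 1 1] that z by (simp add: neighbours_eq ndist_def)
  ultimately show thesis
    by (intro that[of "card (neighbours G z)"] regular_pair_graph.intro
        regular_pair_graph_axioms.intro pair_graph_axioms) auto
qed

lemma cocktail_partyI:
  assumes "regular_pair_graph G k" "card (pverts G) = k + 2"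
  shows "cocktail_party_graph G k"
  using assms by (simp add: cocktail_party_graph_def cocktail_party_graph_axioms_def)

text \<open>Grouping by distance from \<open>u\<close> makes the coefficients intersection numbers,
  which depend only on the distance between \<open>u\<close> and \<open>x\<close>.\<close>

lemma sum_neighbours_ndist:
  fixes h :: "nat \<Rightarrow> complex"
  shows "(\<Sum>w\<in>neighbours G x. h (ndist u w)) =
    (\<Sum>i\<le>2. of_nat (card {w \<in> pverts G. ndist u w = i \<and> ndist x w = 1}) * h i)"
proof -
  have fin: "finite (neighbours G x)" using pair_finite_verts by (simp add: neighbours_eq)
  have "(\<Sum>w\<in>neighbours G x. h (ndist u w)) =
      (\<Sum>i\<le>2. \<Sum>w\<in>{w \<in> neighbours G x. ndist u w = i}. h (ndist u w))"
    by (rule sum.group[symmetric]) (use fin ndist_le in auto)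
  also have "\<dots> = (\<Sum>i\<le>2. of_nat (card {w \<in> neighbours G x. ndist u w = i}) * h i)"
    by (intro sum.cong refl) simp
  also have "\<dots> = (\<Sum>i\<le>2. of_nat (card {w \<in> pverts G. ndist u w = i \<and> ndist x w = 1}) * h i)"
    by (intro sum.cong refl arg_cong2[of _ _ _ _ "(*)"] arg_cong[of _ _ of_nat] arg_cong[of _ _ card])
      (auto simp: neighbours_eq)
  finally show ?thesis .
qed

text \<open>Both starting values are constant on the spheres around \<open>u\<close>, and the
  intersection numbers carry this through the recurrence.\<close>

lemma inflow_eq_if_ndist_eq:
  assumes "regular_pair_graph G k" "u \<in> pverts G"
    and "x \<in> pverts G" "y \<in> pverts G" "ndist u x = ndist u y"
  shows "inflow G u n x = inflow G u n y"
proof -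
  interpret regular_pair_graph G k by (fact assms(1))
  show ?thesis
    using assms(3-5)
  proof (induction n arbitrary: x y rule: induct_nat_012)
    case 0
    then show ?case using assms(2) by (auto simp: inflow_0 ndist_eq_0_iff ndist_def split: if_splits)
  next
    case 1
    then show ?case using assms(2) by (simp add: inflow_1 neighbours_eq)
  next
    case (ge2 n)
    \<comment> \<open>This is the common inflow on the sphere of radius \<open>i\<close>. On an
      empty sphere the choice is arbitrary, but the count multiplying it is then 0.\<close>
    define h where "h i = inflow G u (Suc n) (SOME z. z \<in> pverts G \<and> ndist u z = i)" for i
    have h: "inflow G u (Suc n) z = h (ndist u z)" if "z \<in> pverts G" for z
    proof -
      let ?z = "SOME z'. z' \<in> pverts G \<and> ndist u z' = ndist u z"
      have "?z \<in> pverts G \<and> ndist u ?z = ndist u z"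
        by (rule someI[of _ z]) (use that in simp)
      then show ?thesis unfolding h_def using that by (intro ge2.IH(2)) auto
    qed
    have "(\<Sum>w\<in>neighbours G z. inflow G u (Suc n) w) =
        (\<Sum>i\<le>2. of_nat (card {w \<in> pverts G. ndist u w = i \<and> ndist z w = 1}) * h i)" for z
      unfolding sum_neighbours_ndist[symmetric]
      by (intro sum.cong h) (auto simp: neighbours_eq)
    then have "(\<Sum>w\<in>neighbours G x. inflow G u (Suc n) w) = (\<Sum>w\<in>neighbours G y. inflow G u (Suc n) w)"
      using card_ndist[OF assms(2) ge2.prems(1) assms(2) ge2.prems(2,3)] by simp
    then show ?case
      using ge2.prems(1,2) ge2.IH(1)[OF ge2.prems] by (simp add: inflow_Suc_Suc)
  qed
qed

lemma perfect_state_transfer_imp_cocktail_party: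
  assumes "perfect_state_transfer G"
  obtains k where "cocktail_party_graph G k" "k = 2 \<or> k = 4"
proof -
  obtain k where k: "regular_pair_graph G k" "k \<ge> 2" by (rule regularE)
  interpret regular_pair_graph G k by (fact k(1))
  obtain u v \<tau> \<gamma> where uv: "u \<in> pverts G" "v \<in> pverts G" "u \<noteq> v" "\<tau> > 0" "cmod \<gamma> = 1"
    and pst: "\<And>a. a \<in> parcs G \<Longrightarrow> grover_walk G u \<tau> a = \<gamma> * vertex_state G v a"
    using assms unfolding perfect_state_transfer_def grover_walk_def by blast
  have flow: "inflow G u \<tau> x = (if x = v then \<gamma> * of_real (sqrt (real k)) else 0)"
    if "x \<in> pverts G" for x
    using inflow_perfect_state_transfer[OF uv(2) that pst] by simp
  have nz: "\<gamma> * of_real (sqrt (real k)) \<noteq> 0"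
    using uv(5) degree_pos by auto
  \<comment> \<open>Another vertex of this sphere would share the nonzero inflow of
    \<open>v\<close>, whereas transfer leaves inflow at \<open>v\<close> alone.\<close>
  have alone: "{w \<in> pverts G. ndist u w = ndist u v} = {v}"
  proof -
    have "x = v" if "x \<in> pverts G" "ndist u x = ndist u v" for x
      using inflow_eq_if_ndist_eq[OF k(1) uv(1) that(1) uv(2) that(2), of \<tau>] nz
      by (simp add: flow[OF that(1)] flow[OF uv(2)] split: if_splits)
    then show ?thesis using uv(2) by blast
  qed
  have nbu: "card (neighbours G u) = k" using card_neighbours uv(1) by simp
  \<comment> \<open>Otherwise \<open>v\<close> would be the only neighbour of \<open>u\<close>,
    against \<open>k \<ge> 2\<close>.\<close>
  have "ndist u v \<noteq> 1"
    using alone nbu k(2) by (auto simp: neighbours_eq)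
  then have uv2: "ndist u v = 2"
    using uv(3) by (simp add: ndist_def split: if_splits)
  \<comment> \<open>The spheres of radius 0, 1, 2 around \<open>u\<close> exhaust the graph and have
    sizes 1, \<open>k\<close>, 1.\<close>
  have verts: "pverts G = insert u (insert v (neighbours G u))"
  proof -
    have "w = u \<or> w = v \<or> w \<in> neighbours G u" if "w \<in> pverts G" for w
    proof -
      have "ndist u w = 0 \<or> ndist u w = 1 \<or> ndist u w = 2" using ndist_le[of u w] by linarith
      then show ?thesis using that alone by (auto simp: uv2 ndist_eq_0_iff neighbours_eq)
    qed
    then show ?thesis using uv(1,2) by (auto simp: neighbours_eq)
  qed
  have notin: "u \<notin> neighbours G u" "v \<notin> neighbours G u"
    using uv2 by (auto simp: neighbours_eq ndist_def)
  have "card (pverts G) = k + 2"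
    using nbu notin uv(3) finite_neighbours by (subst verts) simp
  then have cp: "cocktail_party_graph G k" by (rule cocktail_partyI[OF k(1)])
  have "neighbours G u = pverts G - {u, v}"
    using verts notin by blast
  then have "k dvd 4"
    using cocktail_party_graph.degree_dvd_4[OF cp uv(1-3) _ uv(4) flow] by blast
  moreover have "k \<le> 4" using \<open>k dvd 4\<close> by (intro dvd_imp_le) auto
  ultimately have "k = 2 \<or> k = 4"
    using k(2) by (cases "k = 3") auto
  with cp that show thesis by blast
qed

end

section \<open>Isomorphisms\<close>

text \<open>Arcs are ordered pairs, so the vertex bijection dictates the arc map
  \<open>map_prod f f\<close>. Every arc of \<open>H\<close> is reached because its ends lie in the
  image of \<open>f\<close>.\<close>

lemma pair_digraph_isoI:
  assumes "pair_wf_digraph G" "bij_betw f (pverts G) (pverts H)" "parcs H \<subseteq> pverts H \<times> pverts H"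
    and arcs: "\<And>x y. x \<in> pverts G \<Longrightarrow> y \<in> pverts G \<Longrightarrow> (x, y) \<in> parcs G \<longleftrightarrow> (f x, f y) \<in> parcs H"
  shows "digraph_iso (with_proj G) (with_proj H)"
proof -
  interpret pair_wf_digraph G by (fact assms(1))
  let ?h = "\<lparr>iso_verts = f, iso_arcs = map_prod f f, iso_head = snd, iso_tail = fst\<rparr>"
  have inj: "inj_on f (pverts G)" and img: "f ` pverts G = pverts H"
    using assms(2) by (auto simp: bij_betw_def)
  have sub: "parcs G \<subseteq> pverts G \<times> pverts G"
    using in_arcsD1 in_arcsD2 by auto
  have "pre_digraph.digraph_isomorphism (with_proj G) ?h"
    using inj wf_digraph_axioms inj_on_subset[OF map_prod_inj_on[OF inj inj] sub]
    by (simp add: pre_digraph.digraph_isomorphism_def)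
  moreover have "map_prod f f ` parcs G = parcs H"
  proof (intro equalityI subrelI)
    fix a b assume "(a, b) \<in> map_prod f f ` parcs G"
    then obtain x y where xy: "(x, y) \<in> parcs G" "a = f x" "b = f y" by auto
    then have "x \<in> pverts G" "y \<in> pverts G" using sub by auto
    then show "(a, b) \<in> parcs H" using arcs xy by simp
  next
    fix a b assume ab: "(a, b) \<in> parcs H"
    then obtain x y where xy: "x \<in> pverts G" "y \<in> pverts G" "a = f x" "b = f y"
      using assms(3) img by blast
    then have "(x, y) \<in> parcs G" using arcs ab by blast
    then show "(a, b) \<in> map_prod f f ` parcs G"
      using xy by (intro image_eqI[of _ _ "(x, y)"]) auto
  qed
  then have "with_proj H = app_iso ?h (with_proj G)"
    using img by (simp add: app_iso_def with_proj_def)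
  ultimately show ?thesis unfolding digraph_iso_def by blast
qed

text \<open>These counts are all that the converse extracts from an isomorphism; with regularity
  they determine the degree.\<close>

lemma digraph_iso_card_eq:
  assumes "digraph_iso G H"
  shows "card (verts G) = card (verts H)" "card (arcs G) = card (arcs H)"
  using assms by (auto simp: digraph_iso_def pre_digraph.digraph_isomorphism_def card_image)

lemma (in regular_pair_graph) card_parcs: "card (parcs G) = card (pverts G) * k"
proof -
  have "parcs G = prod.swap ` (SIGMA x:pverts G. neighbours G x)"
    using in_arcsD2 by (force simp: neighbours_def)
  then have "card (parcs G) = card (SIGMA x:pverts G. neighbours G x)"
    by (simp add: card_image)
  also have "\<dots> = (\<Sum>x\<in>pverts G. card (neighbours G x))"
    using pair_finite_verts finite_neighbours by (intro card_SigmaI) auto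
  finally show ?thesis by (simp add: card_neighbours)
qed

lemma cycle_graph_4: "card (pverts (cycle_graph 4)) = 4" "card (parcs (cycle_graph 4)) = 8"
proof -
  have pred: "j = (i + 3) mod 4" if "i < 4" "j < 4" "i = (j + 1) mod 4" for i j :: nat
    using that by presburger
  have succ: "i = ((i + 3) mod 4 + 1) mod 4" if "i < 4" for i :: nat
    using that by presburger
  \<comment> \<open>The predecessor of \<open>i\<close> modulo 4 is \<open>i + 3\<close>; it differs
    from the successor by 2, so each vertex has two neighbours.\<close>
  have "parcs (cycle_graph 4) = (SIGMA i:{..<4}. {(i + 1) mod 4, (i + 3) mod 4})"
  proof (intro equalityI subrelI)
    fix i j assume "(i, j) \<in> parcs (cycle_graph 4)"
    then have "i < 4" "j < 4" "j = (i + 1) mod 4 \<or> i = (j + 1) mod 4"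
      by (simp_all add: cycle_graph_def)
    with pred[of i j] show "(i, j) \<in> (SIGMA i:{..<4}. {(i + 1) mod 4, (i + 3) mod 4})"
      by blast
  next
    fix i j :: nat assume "(i, j) \<in> (SIGMA i:{..<4}. {(i + 1) mod 4, (i + 3) mod 4})"
    then have "i < 4" "j = (i + 1) mod 4 \<or> j = (i + 3) mod 4" by blast+
    moreover from this have "j < 4" by auto
    ultimately have "j = (i + 1) mod 4 \<or> i = (j + 1) mod 4" using succ[of i] by blast
    then show "(i, j) \<in> parcs (cycle_graph 4)"
      using \<open>i < 4\<close> \<open>j < 4\<close> by (simp add: cycle_graph_def)
  qed
  also have "card \<dots> = (\<Sum>i\<in>{..<4 :: nat}. card {(i + 1) mod 4, (i + 3) mod 4})"
    by (intro card_SigmaI) auto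
  also have "\<dots> = (\<Sum>i\<in>{..<4 :: nat}. 2)"
  proof (intro sum.cong refl)
    fix i :: nat
    have "(i + 1) mod 4 \<noteq> (i + 3) mod 4" by presburger
    then show "card {(i + 1) mod 4, (i + 3) mod 4} = 2" by simp
  qed
  finally show "card (parcs (cycle_graph 4)) = 8" by simp
qed (simp add: cycle_graph_def)

lemma pverts_complete_multipartite_graph_222:
  "pverts (complete_multipartite_graph [2, 2, 2]) = {0, 1, 2} \<times> {0, 1}"
proof -
  have lt3: "p < 3 \<longleftrightarrow> p \<in> {0, 1, 2}" and lt2: "p < 2 \<longleftrightarrow> p \<in> {0, 1}" for p :: nat
    by (simp, presburger, simp, presburger)
  have "[2, 2, 2] ! p = (2 :: nat)" if "p \<in> {0, 1, 2 :: nat}" for p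
    using that by auto
  then have nth: "p \<in> {0, 1, 2} \<and> i < [2, 2, 2] ! p \<longleftrightarrow> p \<in> {0, 1, 2} \<and> i \<in> {0, 1}" for p i :: nat
    by (metis lt2)
  have "pverts (complete_multipartite_graph [2, 2, 2]) = {(p, i). p < 3 \<and> i < [2, 2, 2] ! p}"
    by (simp add: complete_multipartite_graph_def Let_def numeral_3_eq_3)
  also have "\<dots> = {0, 1, 2} \<times> {0, 1}"
    unfolding lt3 nth by blast
  finally show ?thesis .
qed

lemma parcs_complete_multipartite_graph:
  "parcs (complete_multipartite_graph ns) =
    {(x, y). x \<in> pverts (complete_multipartite_graph ns) \<and>
      y \<in> pverts (complete_multipartite_graph ns) \<and> fst x \<noteq> fst y}"
  by (simp add: complete_multipartite_graph_def Let_def)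

lemma complete_multipartite_graph_222:
  "card (pverts (complete_multipartite_graph [2, 2, 2])) = 6"
  "card (parcs (complete_multipartite_graph [2, 2, 2])) = 24"
proof -
  show "card (pverts (complete_multipartite_graph [2, 2, 2])) = 6"
    by (simp add: pverts_complete_multipartite_graph_222)
  define A B :: "nat set" where "A = {0, 1, 2}" and "B = {0, 1}"
  have AB: "finite A" "finite B" "card A = 3" "card B = 2"
    by (simp_all add: A_def B_def)
  \<comment> \<open>Each of the 6 vertices is adjacent to the 4 vertices in the other two
    parts.\<close>
  have "parcs (complete_multipartite_graph [2, 2, 2]) = (SIGMA x:A \<times> B. (A - {fst x}) \<times> B)"
    unfolding parcs_complete_multipartite_graph pverts_complete_multipartite_graph_222
      A_def[symmetric] B_def[symmetric] by auto
  also have "card \<dots> = (\<Sum>x\<in>A \<times> B. card ((A - {fst x}) \<times> B))"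
    using AB by (intro card_SigmaI) auto
  also have "\<dots> = (\<Sum>x\<in>A \<times> B. 4)"
    using AB by (intro sum.cong refl) (auto simp: card_cartesian_product)
  finally show "card (parcs (complete_multipartite_graph [2, 2, 2])) = 24"
    using AB by (simp add: card_cartesian_product)
qed

section \<open>Identification of the cocktail party graphs of degree 2 and 4\<close>

context cocktail_party_graph
begin

text \<open>These sets are the unions of antipodal pairs, so pairs can be split off one at a
  time.\<close>

definition antipodally_closed :: "'a set \<Rightarrow> bool" where
  "antipodally_closed S \<longleftrightarrow> S \<subseteq> pverts G \<and> (\<forall>x\<in>S. \<exists>x'\<in>S. neighbours G x = pverts G - {x, x'})"

text \<open>The antipode \<open>x'\<close> of a vertex \<open>x\<close> outside \<open>S\<close> is
  also outside: otherwise \<open>S\<close> would contain the unique partner of \<open>x'\<close>,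
  which is \<open>x\<close>.\<close>

lemma antipodal_pairE:
  assumes S: "antipodally_closed S" "card S < k + 2"
  obtains x x' where "x \<in> pverts G - S" "x' \<in> pverts G - S" "x \<noteq> x'"
    "neighbours G x = pverts G - {x, x'}" "neighbours G x' = pverts G - {x', x}"
    "antipodally_closed (insert x (insert x' S))"
proof -
  have "S \<noteq> pverts G" "S \<subseteq> pverts G"
    using S card_verts by (auto simp: antipodally_closed_def)
  then obtain x where x: "x \<in> pverts G" "x \<notin> S" by blast
  then obtain x' where x': "x' \<in> pverts G" "x' \<noteq> x" "neighbours G x = pverts G - {x, x'}"
    using antipodeE by blast
  then have nb': "neighbours G x' = pverts G - {x', x}"
    using antipode_commute x by blast
  moreover have "x' \<notin> S"
  proof
    assume "x' \<in> S"
    then obtain y where "y \<in> S" "neighbours G x' = pverts G - {x', y}"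
      using S(1) by (auto simp: antipodally_closed_def)
    with nb' x x' show False by blast
  qed
  moreover have "antipodally_closed (insert x (insert x' S))"
    using S(1) x(1) x'(1,3) nb' unfolding antipodally_closed_def by (metis insert_iff insert_subset)
  ultimately show thesis using that[of x x'] x x' by blast
qed

lemma iso_cycle_graph_4:
  assumes "k = 2"
  shows "digraph_iso (with_proj G) (with_proj (cycle_graph 4))"
proof -
  obtain u u' where u: "u \<in> pverts G" "u' \<in> pverts G" "u \<noteq> u'"
    "neighbours G u = pverts G - {u, u'}" "neighbours G u' = pverts G - {u', u}"
    and U: "antipodally_closed {u, u'}"
    using antipodal_pairE[of "{}"] by (auto simp: antipodally_closed_def)
  obtain w w' where w: "w \<in> pverts G - {u, u'}" "w' \<in> pverts G - {u, u'}" "w \<noteq> w'"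
    "neighbours G w = pverts G - {w, w'}" "neighbours G w' = pverts G - {w', w}"
    and W: "antipodally_closed {w, w', u, u'}"
    using antipodal_pairE[OF U] u(3) assms by auto
  have dist: "distinct [u, w, u', w']" using u w by auto
  then have V: "pverts G = {u, w, u', w'}"
    using u w card_verts assms pair_finite_verts
    by (intro card_subset_eq[symmetric]) auto
  have nb: "neighbours G u = {w, w'}" "neighbours G u' = {w, w'}"
      "neighbours G w = {u, u'}" "neighbours G w' = {u, u'}"
    using u(4,5) w(4,5) dist unfolding V by auto
  \<comment> \<open>Antipodes lie opposite each other on the cycle, hence the labels 0, 2 and 1,
    3.\<close>
  define f :: "'a \<Rightarrow> nat" where
    "f x = (if x = u then 0 else if x = w then 1 else if x = u' then 2 else 3)" for x
  show ?thesis
  proof (rule pair_digraph_isoI[of _ f])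
    show "pair_wf_digraph G" ..
    show "bij_betw f (pverts G) (pverts (cycle_graph 4))"
      unfolding bij_betw_def V using dist
      by (auto simp: f_def inj_on_def cycle_graph_def)
    show "parcs (cycle_graph 4) \<subseteq> pverts (cycle_graph 4) \<times> pverts (cycle_graph 4)"
      by (auto simp: cycle_graph_def)
    fix x y assume "x \<in> pverts G" "y \<in> pverts G"
    moreover have "(x, y) \<in> parcs G \<longleftrightarrow> x \<in> neighbours G y" by (simp add: neighbours_def)
    ultimately show "(x, y) \<in> parcs G \<longleftrightarrow> (f x, f y) \<in> parcs (cycle_graph 4)"
      using dist unfolding V by (auto simp: nb f_def cycle_graph_def)
  qed
qed

lemma iso_complete_multipartite_graph_222:
  assumes "k = 4"
  shows "digraph_iso (with_proj G) (with_proj (complete_multipartite_graph [2, 2, 2]))"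
proof -
  obtain u u' where u: "u \<in> pverts G" "u' \<in> pverts G" "u \<noteq> u'"
    "neighbours G u = pverts G - {u, u'}" "neighbours G u' = pverts G - {u', u}"
    and U: "antipodally_closed {u, u'}"
    using antipodal_pairE[of "{}"] by (auto simp: antipodally_closed_def)
  obtain w w' where w: "w \<in> pverts G - {u, u'}" "w' \<in> pverts G - {u, u'}" "w \<noteq> w'"
    "neighbours G w = pverts G - {w, w'}" "neighbours G w' = pverts G - {w', w}"
    and W: "antipodally_closed {w, w', u, u'}"
    using antipodal_pairE[OF U] u(3) assms by auto
  obtain z z' where z: "z \<in> pverts G - {w, w', u, u'}" "z' \<in> pverts G - {w, w', u, u'}" "z \<noteq> z'"
    "neighbours G z = pverts G - {z, z'}" "neighbours G z' = pverts G - {z', z}"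
  proof (rule antipodal_pairE[OF W])
    show "card {w, w', u, u'} < k + 2" using u(3) w(1-3) assms by auto
  qed
  have dist: "distinct [u, u', w, w', z, z']" using u w z by auto
  then have V: "pverts G = {u, u', w, w', z, z'}"
    using u w z card_verts assms pair_finite_verts
    by (intro card_subset_eq[symmetric]) auto
  have nb: "neighbours G u = {w, w', z, z'}" "neighbours G u' = {w, w', z, z'}"
      "neighbours G w = {u, u', z, z'}" "neighbours G w' = {u, u', z, z'}"
      "neighbours G z = {u, u', w, w'}" "neighbours G z' = {u, u', w, w'}"
    unfolding u(4,5) w(4,5) z(4,5) V using dist by auto
  \<comment> \<open>Antipodal pairs become parts: the first coordinate names the pair, the second
    separates its two members.\<close>
  define f :: "'a \<Rightarrow> nat \<times> nat" where
    "f x = (if x \<in> {u, u'} then 0 else if x \<in> {w, w'} then 1 else 2, if x \<in> {u, w, z} then 0 else 1)" for x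
  have f: "f u = (0, 0)" "f u' = (0, 1)" "f w = (1, 0)" "f w' = (1, 1)" "f z = (2, 0)" "f z' = (2, 1)"
    using dist by (auto simp: f_def)
  have img: "f ` pverts G = pverts (complete_multipartite_graph [2, 2, 2])"
    unfolding V pverts_complete_multipartite_graph_222 image_insert f by auto
  have adj: "\<forall>y\<in>pverts G. \<forall>x\<in>pverts G. x \<in> neighbours G y \<longleftrightarrow> fst (f x) \<noteq> fst (f y)"
    unfolding V using dist by (simp add: nb f) metis
  show ?thesis
  proof (rule pair_digraph_isoI[of _ f])
    show "pair_wf_digraph G" ..
    \<comment> \<open>Surjectivity and equal finite cardinalities yield injectivity.\<close>
    have "card (f ` pverts G) = card (pverts G)"
      unfolding img complete_multipartite_graph_222 using card_verts assms by simp
    then show "bij_betw f (pverts G) (pverts (complete_multipartite_graph [2, 2, 2]))"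
      unfolding bij_betw_def using img pair_finite_verts eq_card_imp_inj_on by blast
    show "parcs (complete_multipartite_graph [2, 2, 2]) \<subseteq>
        pverts (complete_multipartite_graph [2, 2, 2]) \<times> pverts (complete_multipartite_graph [2, 2, 2])"
      by (auto simp: parcs_complete_multipartite_graph)
    fix x y assume xy: "x \<in> pverts G" "y \<in> pverts G"
    have "(x, y) \<in> parcs G \<longleftrightarrow> fst (f x) \<noteq> fst (f y)"
      using adj xy by (simp add: neighbours_def)
    then show "(x, y) \<in> parcs G \<longleftrightarrow> (f x, f y) \<in> parcs (complete_multipartite_graph [2, 2, 2])"
      using xy by (simp add: parcs_complete_multipartite_graph flip: img)
  qed
qed

end

theorem theorem4p5:
  fixes G :: "'a pair_pre_digraph"
  assumes "pair_graph G" and "distance_regular G" and "graph_diameter G = 2"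
  shows "perfect_state_transfer G \<longleftrightarrow>
           digraph_iso (with_proj G) (with_proj (cycle_graph 4)) \<or>
           digraph_iso (with_proj G) (with_proj (complete_multipartite_graph [2, 2, 2]))"
proof
  interpret distance_regular_diameter_2 G
    using assms by (simp add: distance_regular_diameter_2_def distance_regular_diameter_2_axioms_def)
  show "perfect_state_transfer G \<Longrightarrow> digraph_iso (with_proj G) (with_proj (cycle_graph 4)) \<or>
      digraph_iso (with_proj G) (with_proj (complete_multipartite_graph [2, 2, 2]))"
    by (metis perfect_state_transfer_imp_cocktail_party cocktail_party_graph.iso_cycle_graph_4
        cocktail_party_graph.iso_complete_multipartite_graph_222)
  assume iso: "digraph_iso (with_proj G) (with_proj (cycle_graph 4)) \<or>
      digraph_iso (with_proj G) (with_proj (complete_multipartite_graph [2, 2, 2]))"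
  obtain k where k: "regular_pair_graph G k" "k \<ge> 2" by (rule regularE)
  then interpret regular_pair_graph G k by simp
  \<comment> \<open>A \<open>k\<close>-regular graph on \<open>n\<close> vertices has
    \<open>n * k\<close> arcs. The counts 4 and 8, or 6 and 24, give \<open>k = 2\<close> or
    \<open>k = 4\<close>, and \<open>n = k + 2\<close> in both cases.\<close>
  have "card (pverts G) = k + 2 \<and> (k = 2 \<or> k = 4)"
    using iso
  proof
    assume "digraph_iso (with_proj G) (with_proj (cycle_graph 4))"
    from digraph_iso_card_eq[OF this] show ?thesis
      using card_parcs by (simp add: cycle_graph_4)
  next
    assume "digraph_iso (with_proj G) (with_proj (complete_multipartite_graph [2, 2, 2]))"
    from digraph_iso_card_eq[OF this] show ?thesis
      using card_parcs by (simp add: complete_multipartite_graph_222)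
  qed
  then show "perfect_state_transfer G"
    using cocktail_partyI[OF k(1)] cocktail_party_graph.perfect_state_transfer_if_degree by blast
qed

end
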